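(* Let $A$ be a ring. Then the mapping on ideals of $A$ given by $I \mapsto I^{\natural}$ is a closure operation.
   Context: All rings are commutative with identity. For an ideal $I$ of a ring $A$, let $I^{\#}$ be the ideal of $A$ generated by $\{x \in A \mid x^n \in I^n \text{ for some } n \ge 1\}$; let $I^{\#_1} = I^{\#}$ and, for $\ell > 1$, $I^{\#_\ell} = \langle x \in A \mid x^n \in (I^{\#_{\ell-1}})^n \text{ for some } n \ge 1\rangle$; let $I^{\boxed{\#}} = \bigcup_{\ell \ge 1} I^{\#_\ell}$ (an increasing union of ideals); and let $I^{\natural} = \{x \in A \mid x^n \in (I^n)^{\boxed{\#}} \text{ for some } n \ge 1\}$, which is an ideal of $A$. A closure operation $\square$ on the set of ideals of $A$ is a mapping $I \mapsto I^{\square}$ from ideals to ideals such that: (1) $I \subseteq I^{\square}$ for all ideals $I$ of $A$; (2) for all ideals $I, J$ of $A$ with $I \subseteq J$, $I^{\square} \subseteq J^{\square}$; (3) $I^{\square} = (I^{\square})^{\square}$ for all ideals $I$ of $A$. *)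

theory Defs
  imports "HOL-Algebra.Ideal_Product"
begin

abbreviation ideal_power :: "('a, 'b) ring_scheme \<Rightarrow> 'a set \<Rightarrow> nat \<Rightarrow> 'a set"
  where "ideal_power A I n \<equiv> I [^]\<^bsub>ideals_set A\<^esub> n"

definition ideal_sharp :: "('a, 'b) ring_scheme \<Rightarrow> 'a set \<Rightarrow> 'a set"
  where "ideal_sharp A I =
    Idl\<^bsub>A\<^esub> {x \<in> carrier A. \<exists>n::nat. n \<ge> 1 \<and> x [^]\<^bsub>A\<^esub> n \<in> ideal_power A I n}"

text \<open>The \<open>l\<close>-fold iterate of \<^const>\<open>ideal_sharp\<close> is the paper's $I^{\#_l}$ for \<open>l \<ge> 1\<close>;
  the zeroth iterate, which is \<open>I\<close> itself, is excluded from the union below.\<close>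

definition ideal_box_sharp :: "('a, 'b) ring_scheme \<Rightarrow> 'a set \<Rightarrow> 'a set"
  where "ideal_box_sharp A I = (\<Union>l\<in>{1::nat..}. (ideal_sharp A ^^ l) I)"

definition ideal_natural :: "('a, 'b) ring_scheme \<Rightarrow> 'a set \<Rightarrow> 'a set"
  where "ideal_natural A I =
    {x \<in> carrier A. \<exists>n::nat. n \<ge> 1 \<and> x [^]\<^bsub>A\<^esub> n \<in> ideal_box_sharp A (ideal_power A I n)}"

definition ideal_closure_operation ::
    "('a, 'b) ring_scheme \<Rightarrow> ('a set \<Rightarrow> 'a set) \<Rightarrow> bool"
  where "ideal_closure_operation A cl \<longleftrightarrow>
    cl \<in> {I. ideal I A} \<rightarrow> {I. ideal I A} \<and>
    (\<forall>I. ideal I A \<longrightarrow> I \<subseteq> cl I) \<and>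
    (\<forall>I J. ideal I A \<longrightarrow> ideal J A \<longrightarrow> I \<subseteq> J \<longrightarrow> cl I \<subseteq> cl J) \<and>
    (\<forall>I. ideal I A \<longrightarrow> cl I = cl (cl I))"

end

theory Submission
  imports Defs
begin

text \<open>
  Call an ideal \<open>J\<close> sharp-closed if \<open>x\<^sup>n \<in> J\<^sup>n\<close> with \<open>n \<ge> 1\<close> forces \<open>x \<in> J\<close>. Because an element
  of a power of a directed union of ideals already lies in the same power of one member, the
  union \<^const>\<open>ideal_box_sharp\<close> of the iterates is sharp-closed, and it is the least
  sharp-closed ideal above the given one; write \<open>box\<close> for it. Since an element colon ideal \<open>{z. z y \<in> K}\<close> of a sharp-closed \<open>K\<close> is again
  sharp-closed, minimality gives \<open>box I \<cdot> box J \<subseteq> box (I \<cdot> J)\<close>.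

  Everything about \<^const>\<open>ideal_natural\<close> is then read off the levels
  \<open>I\<^sub>N = {x. x\<^sup>N \<in> box (I\<^sup>N)}\<close>, \<open>N \<ge> 1\<close>, whose union it is. Each level is an ideal. For sums, put
  \<open>B = box (I\<^sup>N)\<close>: if \<open>x\<^sup>N, y\<^sup>N \<in> B\<close> and \<open>i + j = N\<close>, then \<open>(x\<^sup>i y\<^sup>j)\<^sup>N \<in> B\<^sup>N\<close>, so \<open>x\<^sup>i y\<^sup>j \<in> B\<close> because
  \<open>B\<close> is sharp-closed, and \<open>(x + y)\<^sup>N\<close> is a sum of multiples of such monomials. Multiplicativity
  of box makes the levels directed by divisibility of \<open>N\<close> and gives \<open>(I\<^sub>N)\<^sup>m \<subseteq> (I\<^sup>m)\<^sub>N\<close>.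

  So the natural closure is an ideal, and it is sharp-closed: if \<open>x\<^sup>m \<in> (natural I)\<^sup>m\<close>, then
  \<open>x\<^sup>m \<in> (I\<^sub>N)\<^sup>m \<subseteq> (I\<^sup>m)\<^sub>N\<close> for one \<open>N\<close>, that is, \<open>x \<in> I\<^bsub>mN\<^esub>\<close>. Likewise
  \<open>(natural I)\<^sup>m \<subseteq> natural (I\<^sup>m)\<close>, and as the right-hand side is sharp-closed it contains
  \<open>box ((natural I)\<^sup>m)\<close>. Hence \<open>x \<in> natural (natural I)\<close> yields \<open>x\<^sup>m \<in> natural (I\<^sup>m)\<close> for some
  \<open>m \<ge> 1\<close>, which means \<open>x \<in> natural I\<close>.
\<close>

section \<open>Powers of ideals\<close>

context cring
begin

lemma ideal_power_0: "ideal_power R I 0 = carrier R"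
  by (simp add: ideals_set_def)

lemma ideal_power_Suc: "ideal_power R I (Suc n) = ideal_power R I n \<cdot> I"
  by (simp add: ideals_set_def)

lemma ideal_power_is_ideal:
  assumes "ideal I R"
  shows "ideal (ideal_power R I n) R"
  by (induction n) (simp_all only: ideal_power_0 ideal_power_Suc oneideal ideal_prod_is_ideal assms)

lemma ideal_power_one:
  assumes "ideal I R"
  shows "ideal_power R I 1 = I"
proof -
  have "ideal_power R I (Suc 0) = I"
    unfolding ideal_power_Suc ideal_power_0
    using ideal_prod_commute[OF oneideal assms] ideal_prod_one[OF assms] by simp
  thus ?thesis by simp
qed

lemma ideal_power_power:
  assumes "ideal I R"
  shows "ideal_power R (ideal_power R I n) m = ideal_power R I (n * m)"
proof -
  interpret S: comm_monoid "ideals_set R" by (rule ideals_set_is_comm_monoid)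
  show ?thesis
    using S.nat_pow_pow[of I n m] assms by (simp add: ideals_set_def)
qed

lemma ideal_power_prod:
  assumes "ideal I R" "ideal J R"
  shows "ideal_power R (I \<cdot> J) n = ideal_power R I n \<cdot> ideal_power R J n"
proof -
  interpret S: comm_monoid "ideals_set R" by (rule ideals_set_is_comm_monoid)
  show ?thesis
    using S.nat_pow_distrib[of I J n] assms by (simp add: ideals_set_def)
qed

lemma ideal_power_carrier: "ideal_power R (carrier R) n = carrier R"
  by (induction n) (simp_all only: ideal_power_0 ideal_power_Suc ideal_prod_one oneideal)

lemma ideal_prod_mono:
  assumes "I \<subseteq> I'" "J \<subseteq> J'"
  shows "I \<cdot> J \<subseteq> I' \<cdot> J'"
proof
  fix s assume "s \<in> I \<cdot> J"
  thus "s \<in> I' \<cdot> J'"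
    by induction (use assms in \<open>auto intro: ideal_prod.intros\<close>)
qed

lemma ideal_prod_least:
  assumes "ideal K R" "\<And>i j. i \<in> I \<Longrightarrow> j \<in> J \<Longrightarrow> i \<otimes> j \<in> K"
  shows "I \<cdot> J \<subseteq> K"
proof
  fix s assume "s \<in> I \<cdot> J"
  thus "s \<in> K"
    by induction (use assms in \<open>auto intro: additive_subgroup.a_closed ideal.axioms(1)\<close>)
qed

lemma ideal_power_mono: "I \<subseteq> J \<Longrightarrow> ideal_power R I n \<subseteq> ideal_power R J n"
  by (induction n) (simp_all only: ideal_power_0 ideal_power_Suc ideal_prod_mono order_refl)

lemma pow_in_ideal_power:
  assumes "I \<subseteq> carrier R" "x \<in> I"
  shows "x [^] n \<in> ideal_power R I n"
proof (induction n)
  case 0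
  show ?case unfolding ideal_power_0 by simp
next
  case (Suc n)
  show ?case unfolding ideal_power_Suc nat_pow_Suc by (rule ideal_prod.prod[OF Suc assms(2)])
qed

lemma ideal_subset_carrier: "ideal I R \<Longrightarrow> I \<subseteq> carrier R"
  by (rule subsetI) (rule ideal.Icarr)

lemma ideal_add_closed: "ideal I R \<Longrightarrow> x \<in> I \<Longrightarrow> y \<in> I \<Longrightarrow> x \<oplus> y \<in> I"
  by (rule additive_subgroup.a_closed[OF ideal.axioms(1)])

lemma ideal_if_left_closed:
  assumes "I \<subseteq> carrier R" "\<zero> \<in> I"
    and "\<And>x y. x \<in> I \<Longrightarrow> y \<in> I \<Longrightarrow> x \<oplus> y \<in> I"
    and mult: "\<And>a x. a \<in> I \<Longrightarrow> x \<in> carrier R \<Longrightarrow> x \<otimes> a \<in> I"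
  shows "ideal I R"
proof (rule idealI)
  show "subgroup I (add_monoid R)"
  proof (rule add.subgroupI)
    fix a assume a: "a \<in> I"
    hence "a \<in> carrier R" using assms(1) by blast
    hence "\<ominus> a = (\<ominus> \<one>) \<otimes> a" by (simp add: l_minus)
    thus "\<ominus> a \<in> I" using mult[OF a, of "\<ominus> \<one>"] by simp
  qed (use assms in auto)
next
  fix a x assume "a \<in> I" "x \<in> carrier R"
  thus "a \<otimes> x \<in> I" using mult[of a x] assms(1) m_comm[of a x] by auto
qed (use mult ring_axioms in auto)

end

section \<open>Directed unions of ideals\<close>

definition directed_family :: "'a set set \<Rightarrow> bool"
  where "directed_family \<F> \<longleftrightarrow>
    \<F> \<noteq> {} \<and> (\<forall>F\<in>\<F>. \<forall>G\<in>\<F>. \<exists>H\<in>\<F>. F \<subseteq> H \<and> G \<subseteq> H)"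

lemma directed_familyE:
  assumes "directed_family \<F>" "F \<in> \<F>" "G \<in> \<F>"
  obtains H where "H \<in> \<F>" "F \<subseteq> H" "G \<subseteq> H"
  using assms unfolding directed_family_def by blast

context cring
begin

lemma ideal_directed_Union:
  assumes dir: "directed_family \<F>" and id: "\<And>F. F \<in> \<F> \<Longrightarrow> ideal F R"
  shows "ideal (\<Union>\<F>) R"
proof (rule ideal_if_left_closed)
  show "\<Union>\<F> \<subseteq> carrier R" using id ideal_subset_carrier by blast
  obtain F where "F \<in> \<F>" using dir unfolding directed_family_def by blast
  thus "\<zero> \<in> \<Union>\<F>" using id additive_subgroup.zero_closed ideal.axioms(1) by blast
next
  fix x y assume "x \<in> \<Union>\<F>" "y \<in> \<Union>\<F>"
  then obtain F G where "F \<in> \<F>" "G \<in> \<F>" "x \<in> F" "y \<in> G" by blast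
  moreover from this obtain H where "H \<in> \<F>" "F \<subseteq> H" "G \<subseteq> H"
    using directed_familyE[OF dir] by metis
  ultimately show "x \<oplus> y \<in> \<Union>\<F>" using ideal_add_closed[OF id, of H x y] by blast
next
  fix a x assume "a \<in> \<Union>\<F>" "x \<in> carrier R"
  thus "x \<otimes> a \<in> \<Union>\<F>" using ideal.I_l_closed[OF id] by blast
qed

text \<open>An element of a power of an ideal is written with finitely many elements of that ideal;
  in a directed union, one member contains all of them.\<close>

lemma ideal_power_directed_Union:
  assumes dir: "directed_family \<F>" and "z \<in> ideal_power R (\<Union>\<F>) n"
  shows "\<exists>F\<in>\<F>. z \<in> ideal_power R F n"
  using assms(2)
proof (induction n arbitrary: z)
  case 0
  thus ?case using dir unfolding directed_family_def ideal_power_0 by blast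
next
  case (Suc n)
  have "z \<in> ideal_power R (\<Union>\<F>) n \<cdot> \<Union>\<F>" using Suc.prems unfolding ideal_power_Suc .
  thus ?case
  proof induction
    case (prod i j)
    then obtain F G where F: "F \<in> \<F>" "i \<in> ideal_power R F n" and G: "G \<in> \<F>" "j \<in> G"
      using Suc.IH by blast
    then obtain H where H: "H \<in> \<F>" "F \<subseteq> H" "G \<subseteq> H" using directed_familyE[OF dir] by metis
    have "i \<in> ideal_power R H n" using F ideal_power_mono[OF H(2)] by blast
    hence "i \<otimes> j \<in> ideal_power R H (Suc n)"
      unfolding ideal_power_Suc using G H by (blast intro: ideal_prod.prod)
    thus ?case using H by blast
  next
    case (sum s t)
    then obtain F G where F: "F \<in> \<F>" "s \<in> ideal_power R F (Suc n)"
      and G: "G \<in> \<F>" "t \<in> ideal_power R G (Suc n)" by blast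
    then obtain H where H: "H \<in> \<F>" "F \<subseteq> H" "G \<subseteq> H" using directed_familyE[OF dir] by metis
    have "s \<in> ideal_power R H (Suc n)" "t \<in> ideal_power R H (Suc n)"
      using F G ideal_power_mono[OF H(2)] ideal_power_mono[OF H(3)] by blast+
    hence "s \<oplus> t \<in> ideal_power R H (Suc n)"
      unfolding ideal_power_Suc by (rule ideal_prod.sum)
    thus ?case using H by blast
  qed
qed

end

section \<open>Sharp-closed ideals and the box closure\<close>

definition sharp_closed :: "('a, 'b) ring_scheme \<Rightarrow> 'a set \<Rightarrow> bool"
  where "sharp_closed A J \<longleftrightarrow> ideal J A \<and>
    (\<forall>x\<in>carrier A. \<forall>n::nat. n \<ge> 1 \<longrightarrow> x [^]\<^bsub>A\<^esub> n \<in> ideal_power A J n \<longrightarrow> x \<in> J)"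

lemma sharp_closed_is_ideal: "sharp_closed A J \<Longrightarrow> ideal J A"
  by (simp add: sharp_closed_def)

lemma sharp_closedD:
  "sharp_closed A J \<Longrightarrow> x \<in> carrier A \<Longrightarrow> n \<ge> 1 \<Longrightarrow> x [^]\<^bsub>A\<^esub> (n::nat) \<in> ideal_power A J n \<Longrightarrow> x \<in> J"
  by (simp add: sharp_closed_def)

context cring
begin

lemma ideal_sharp_is_ideal: "ideal (ideal_sharp R I) R"
  unfolding ideal_sharp_def by (rule genideal_ideal) blast

lemma ideal_sharp_memI:
  assumes "x \<in> carrier R" "n \<ge> 1" "x [^] (n::nat) \<in> ideal_power R I n"
  shows "x \<in> ideal_sharp R I"
proof -
  have "{x \<in> carrier R. \<exists>n::nat. n \<ge> 1 \<and> x [^] n \<in> ideal_power R I n} \<subseteq> ideal_sharp R I"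
    unfolding ideal_sharp_def by (rule genideal_self) blast
  thus ?thesis using assms by blast
qed

lemma subset_ideal_sharp:
  assumes "ideal I R"
  shows "I \<subseteq> ideal_sharp R I"
proof
  fix x assume x: "x \<in> I"
  have "x [^] (1::nat) \<in> ideal_power R I 1"
    by (rule pow_in_ideal_power[OF ideal_subset_carrier[OF assms] x])
  thus "x \<in> ideal_sharp R I" by (rule ideal_sharp_memI[OF ideal.Icarr[OF assms x] le_refl])
qed

lemma ideal_sharp_least:
  assumes "sharp_closed R J" "I \<subseteq> J"
  shows "ideal_sharp R I \<subseteq> J"
  unfolding ideal_sharp_def
proof (rule genideal_minimal[OF sharp_closed_is_ideal[OF assms(1)]], safe)
  fix x and n :: nat
  assume "x \<in> carrier R" "n \<ge> 1" "x [^] n \<in> ideal_power R I n"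
  thus "x \<in> J" using ideal_power_mono[OF assms(2)] sharp_closedD[OF assms(1)] by blast
qed

lemma sharp_iterate_is_ideal:
  assumes "ideal I R"
  shows "ideal ((ideal_sharp R ^^ l) I) R"
  by (cases l) (simp_all add: assms ideal_sharp_is_ideal)

lemma sharp_iterate_mono:
  assumes "ideal I R" "k \<le> l"
  shows "(ideal_sharp R ^^ k) I \<subseteq> (ideal_sharp R ^^ l) I"
proof (rule lift_Suc_mono_le[of "\<lambda>l. (ideal_sharp R ^^ l) I", OF _ assms(2)])
  fix n
  show "(ideal_sharp R ^^ n) I \<subseteq> (ideal_sharp R ^^ Suc n) I"
    using subset_ideal_sharp[OF sharp_iterate_is_ideal[OF assms(1)]] by simp
qed

lemma directed_sharp_iterates:
  assumes "ideal I R"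
  shows "directed_family ((\<lambda>l. (ideal_sharp R ^^ l) I) ` {1..})"
  unfolding directed_family_def
proof (intro conjI ballI, blast)
  fix F G
  assume "F \<in> (\<lambda>l. (ideal_sharp R ^^ l) I) ` {1..}" "G \<in> (\<lambda>l. (ideal_sharp R ^^ l) I) ` {1..}"
  then obtain k l :: nat where "k \<ge> 1" "F = (ideal_sharp R ^^ k) I" "G = (ideal_sharp R ^^ l) I"
    by auto
  thus "\<exists>H\<in>(\<lambda>l. (ideal_sharp R ^^ l) I) ` {1..}. F \<subseteq> H \<and> G \<subseteq> H"
    using sharp_iterate_mono[OF assms, of _ "max k l"]
    by (intro bexI[of _ "(ideal_sharp R ^^ max k l) I"]) auto
qed

text \<open>A witness \<open>x\<^sup>n \<in> (box I)\<^sup>n\<close> already lives in the \<open>n\<close>-th power of some iterate, so \<open>x\<close>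
  appears in the next one.\<close>

lemma sharp_closed_box:
  assumes "ideal I R"
  shows "sharp_closed R (ideal_box_sharp R I)"
proof -
  note dir = directed_sharp_iterates[OF assms]
  have "ideal (ideal_box_sharp R I) R"
    unfolding ideal_box_sharp_def
    by (rule ideal_directed_Union[OF dir]) (use sharp_iterate_is_ideal[OF assms] in auto)
  moreover have "x \<in> ideal_box_sharp R I"
    if x: "x \<in> carrier R" "n \<ge> 1" "x [^] n \<in> ideal_power R (ideal_box_sharp R I) n" for x and n :: nat
  proof -
    obtain l :: nat where "x [^] n \<in> ideal_power R ((ideal_sharp R ^^ l) I) n"
      using ideal_power_directed_Union[OF dir x(3)[unfolded ideal_box_sharp_def]] by blast
    hence "x \<in> (ideal_sharp R ^^ Suc l) I" using ideal_sharp_memI x by simp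
    moreover have "Suc l \<in> {1..}" by simp
    ultimately show ?thesis unfolding ideal_box_sharp_def by blast
  qed
  ultimately show ?thesis unfolding sharp_closed_def by blast
qed

lemma subset_box:
  assumes "ideal I R"
  shows "I \<subseteq> ideal_box_sharp R I"
proof -
  have "(ideal_sharp R ^^ 1) I \<subseteq> ideal_box_sharp R I" unfolding ideal_box_sharp_def by blast
  thus ?thesis using subset_ideal_sharp[OF assms] by simp
qed

lemma box_least:
  assumes "sharp_closed R J" "I \<subseteq> J"
  shows "ideal_box_sharp R I \<subseteq> J"
proof -
  have "(ideal_sharp R ^^ l) I \<subseteq> J" for l
    by (induction l) (simp_all add: assms ideal_sharp_least)
  thus ?thesis unfolding ideal_box_sharp_def by blast
qed

lemma box_mono:
  assumes "ideal J R" "I \<subseteq> J"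
  shows "ideal_box_sharp R I \<subseteq> ideal_box_sharp R J"
  using box_least[OF sharp_closed_box[OF assms(1)]] subset_box[OF assms(1)] assms(2) by blast

text \<open>Multiplying by \<open>y\<^sup>n\<close> takes \<open>(K : y)\<^sup>n\<close> into \<open>K\<^sup>n\<close>, so \<open>x\<^sup>n \<in> (K : y)\<^sup>n\<close> gives
  \<open>(x y)\<^sup>n \<in> K\<^sup>n\<close>, hence \<open>x y \<in> K\<close>.\<close>

lemma sharp_closed_colon:
  assumes K: "sharp_closed R K" and y: "y \<in> carrier R"
  shows "sharp_closed R {z \<in> carrier R. z \<otimes> y \<in> K}" (is "sharp_closed R ?C")
proof -
  note Kid = sharp_closed_is_ideal[OF K]
  have Cid: "ideal ?C R"
  proof (rule ideal_if_left_closed)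
    show "\<zero> \<in> ?C" using y additive_subgroup.zero_closed[OF ideal.axioms(1)[OF Kid]] by simp
    show "x \<oplus> x' \<in> ?C" if "x \<in> ?C" "x' \<in> ?C" for x x'
      using that y ideal_add_closed[OF Kid] by (simp add: l_distr)
    show "x \<otimes> a \<in> ?C" if "a \<in> ?C" "x \<in> carrier R" for a x
      using that y ideal.I_l_closed[OF Kid] by (simp add: m_assoc)
  qed blast
  have pow: "u \<otimes> y [^] n \<in> ideal_power R K n" if "u \<in> ideal_power R ?C n" for u and n :: nat
    using that
  proof (induction n arbitrary: u)
    case 0
    thus ?case unfolding ideal_power_0 by simp
  next
    case (Suc n)
    note Pid = ideal_power_is_ideal[OF Cid, of n]
    have "u \<in> ideal_power R ?C n \<cdot> ?C" using Suc.prems unfolding ideal_power_Suc .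
    thus ?case
    proof induction
      case (prod i j)
      have "i \<in> carrier R" using ideal.Icarr[OF Pid prod(1)] .
      hence "(i \<otimes> j) \<otimes> y [^] Suc n = (i \<otimes> y [^] n) \<otimes> (j \<otimes> y)"
        using prod y by (simp add: m_ac)
      moreover have "(i \<otimes> y [^] n) \<otimes> (j \<otimes> y) \<in> ideal_power R K (Suc n)"
        unfolding ideal_power_Suc using prod Suc.IH by (blast intro: ideal_prod.prod)
      ultimately show ?case by simp
    next
      case (sum s t)
      have "s \<in> carrier R" "t \<in> carrier R"
        using sum ideal_prod_in_carrier[OF Pid Cid] by blast+
      hence eq: "(s \<oplus> t) \<otimes> y [^] Suc n = s \<otimes> y [^] Suc n \<oplus> t \<otimes> y [^] Suc n"
        using y by (intro l_distr) auto
      show ?case unfolding eq by (rule ideal_add_closed[OF ideal_power_is_ideal[OF Kid] sum.IH])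
    qed
  qed
  have "x \<in> ?C" if x: "x \<in> carrier R" "n \<ge> 1" "x [^] n \<in> ideal_power R ?C n" for x and n :: nat
  proof -
    have "(x \<otimes> y) [^] n \<in> ideal_power R K n" using pow[OF x(3)] x y by (simp add: nat_pow_distrib)
    thus ?thesis using sharp_closedD[OF K _ x(2)] x y by simp
  qed
  thus ?thesis unfolding sharp_closed_def using Cid by blast
qed

text \<open>The factors are closed up one at a time: for fixed \<open>j \<in> J\<close> the colon ideal
  \<open>(box (I \<cdot> J) : j)\<close> is sharp-closed and contains \<open>I\<close>, hence \<open>box I\<close>; then, for fixed
  \<open>i \<in> box I\<close>, the ideal \<open>(box (I \<cdot> J) : i)\<close> contains \<open>J\<close>, hence \<open>box J\<close>.\<close>

lemma box_prod_subset:
  assumes I: "ideal I R" and J: "ideal J R"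
  shows "ideal_box_sharp R I \<cdot> ideal_box_sharp R J \<subseteq> ideal_box_sharp R (I \<cdot> J)"
proof -
  let ?K = "ideal_box_sharp R (I \<cdot> J)"
  note IJ = ideal_prod_is_ideal[OF I J]
  note K = sharp_closed_box[OF IJ]
  have half: "i \<otimes> j \<in> ?K" if i: "i \<in> ideal_box_sharp R I" and j: "j \<in> J" for i j
  proof -
    have "I \<subseteq> {z \<in> carrier R. z \<otimes> j \<in> ?K}"
      using j ideal.Icarr[OF I] subset_box[OF IJ] by (blast intro: ideal_prod.prod)
    from box_least[OF sharp_closed_colon[OF K ideal.Icarr[OF J j]] this] show ?thesis
      using i by blast
  qed
  have "i \<otimes> j \<in> ?K" if i: "i \<in> ideal_box_sharp R I" and j: "j \<in> ideal_box_sharp R J" for i j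
  proof -
    have ic: "i \<in> carrier R" using ideal.Icarr[OF sharp_closed_is_ideal[OF sharp_closed_box[OF I]] i] .
    have jc: "j \<in> carrier R" using ideal.Icarr[OF sharp_closed_is_ideal[OF sharp_closed_box[OF J]] j] .
    have "J \<subseteq> {z \<in> carrier R. z \<otimes> i \<in> ?K}"
      using half[OF i] ideal.Icarr[OF J] m_comm[OF ic] by auto
    from box_least[OF sharp_closed_colon[OF K ic] this] show ?thesis
      using j m_comm[OF ic jc] by auto
  qed
  thus ?thesis by (rule ideal_prod_least[OF sharp_closed_is_ideal[OF K]])
qed

lemma box_power_subset:
  assumes "ideal I R"
  shows "ideal_power R (ideal_box_sharp R I) n \<subseteq> ideal_box_sharp R (ideal_power R I n)"
proof (induction n)
  case 0
  show ?case unfolding ideal_power_0 by (rule subset_box[OF oneideal])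
next
  case (Suc n)
  show ?case
    unfolding ideal_power_Suc
    using ideal_prod_mono[OF Suc order_refl]
      box_prod_subset[OF ideal_power_is_ideal[OF assms] assms] by blast
qed

end

section \<open>The levels of the natural closure\<close>

text \<open>Fixing the exponent in \<^const>\<open>ideal_natural\<close> makes closure under addition accessible, since
  two elements of one level are tested against the same ideal. Level \<open>0\<close> is the whole ring, so
  only \<open>N \<ge> 1\<close> counts.\<close>

definition natural_level :: "('a, 'b) ring_scheme \<Rightarrow> 'a set \<Rightarrow> nat \<Rightarrow> 'a set"
  where "natural_level A I N =
    {x \<in> carrier A. x [^]\<^bsub>A\<^esub> N \<in> ideal_box_sharp A (ideal_power A I N)}"

lemma ideal_natural_eq_Union_levels: "ideal_natural A I = \<Union> (natural_level A I ` {1..})"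
  unfolding ideal_natural_def natural_level_def by auto

context cring
begin

text \<open>A binomial expansion in which only membership is tracked: trading factors \<open>x + y\<close> for
  factors \<open>x\<close> or \<open>y\<close> one at a time avoids the binomial coefficients.\<close>

lemma add_pow_in_ideal:
  assumes J: "ideal J R" and x: "x \<in> carrier R" and y: "y \<in> carrier R"
    and mono: "\<And>i j. i + j = n \<Longrightarrow> x [^] i \<otimes> y [^] j \<in> J"
  shows "(x \<oplus> y) [^] (n::nat) \<in> J"
proof -
  have "(x \<oplus> y) [^] k \<otimes> (x [^] i \<otimes> y [^] j) \<in> J" if "i + j + k = n" for i j k :: nat
    using that
  proof (induction k arbitrary: i j)
    case 0
    thus ?case using mono x y by simp
  next
    case (Suc k)
    have eq: "(x \<oplus> y) [^] Suc k \<otimes> (x [^] i \<otimes> y [^] j) =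
        (x \<oplus> y) [^] k \<otimes> (x [^] Suc i \<otimes> y [^] j) \<oplus> (x \<oplus> y) [^] k \<otimes> (x [^] i \<otimes> y [^] Suc j)"
    proof -
      have "(x \<oplus> y) \<otimes> (x [^] i \<otimes> y [^] j) = x \<otimes> (x [^] i \<otimes> y [^] j) \<oplus> y \<otimes> (x [^] i \<otimes> y [^] j)"
        using x y by (simp add: l_distr)
      also have "\<dots> = x [^] Suc i \<otimes> y [^] j \<oplus> x [^] i \<otimes> y [^] Suc j"
        using x y by (simp add: m_ac)
      finally show ?thesis using x y by (simp add: m_assoc r_distr[symmetric])
    qed
    show ?case
      unfolding eq using Suc.IH[of "Suc i" j] Suc.IH[of i "Suc j"] Suc.prems
      by (intro ideal_add_closed[OF J]) simp_all
  qed
  from this[of 0 0 n] show ?thesis using x y by simp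
qed

text \<open>The \<open>n\<close>-th power of the monomial lies in \<open>B\<^sup>i \<cdot> B\<^sup>j = B\<^sup>n\<close>.\<close>

lemma sharp_closed_monomial:
  assumes B: "sharp_closed R B" and x: "x \<in> carrier R" and y: "y \<in> carrier R"
    and "x [^] n \<in> B" "y [^] n \<in> B" "i + j = (n::nat)" "n \<ge> 1"
  shows "x [^] i \<otimes> y [^] j \<in> B"
proof -
  note Bid = sharp_closed_is_ideal[OF B]
  have "(x [^] i \<otimes> y [^] j) [^] n = (x [^] n) [^] i \<otimes> (y [^] n) [^] j"
    using x y by (simp add: nat_pow_distrib nat_pow_pow mult.commute)
  also have "\<dots> \<in> ideal_power R B i \<cdot> ideal_power R B j"
    using pow_in_ideal_power[OF ideal_subset_carrier[OF Bid]] assms by (blast intro: ideal_prod.prod)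
  also have "\<dots> = ideal_power R B n"
  proof -
    interpret S: comm_monoid "ideals_set R" by (rule ideals_set_is_comm_monoid)
    show ?thesis using S.nat_pow_mult[of B i j] Bid assms(6) by (simp add: ideals_set_def)
  qed
  finally show ?thesis using sharp_closedD[OF B _ assms(7)] x y by simp
qed

lemma natural_level_is_ideal:
  assumes I: "ideal I R" and N: "N \<ge> 1"
  shows "ideal (natural_level R I N) R"
proof -
  define B where "B = ideal_box_sharp R (ideal_power R I N)"
  have B: "sharp_closed R B"
    unfolding B_def by (rule sharp_closed_box[OF ideal_power_is_ideal[OF I]])
  note Bid = sharp_closed_is_ideal[OF B]
  have level: "natural_level R I N = {x \<in> carrier R. x [^] N \<in> B}"
    unfolding natural_level_def B_def ..
  show ?thesis
    unfolding level
  proof (rule ideal_if_left_closed)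
    have "\<zero> [^] N = \<zero>" using N by (cases N) auto
    thus "\<zero> \<in> {x \<in> carrier R. x [^] N \<in> B}"
      using additive_subgroup.zero_closed[OF ideal.axioms(1)[OF Bid]] by simp
  next
    fix x y assume "x \<in> {x \<in> carrier R. x [^] N \<in> B}" "y \<in> {x \<in> carrier R. x [^] N \<in> B}"
    hence xy: "x \<in> carrier R" "y \<in> carrier R" "x [^] N \<in> B" "y [^] N \<in> B" by auto
    have "(x \<oplus> y) [^] N \<in> B"
      by (rule add_pow_in_ideal[OF Bid xy(1,2) sharp_closed_monomial[OF B xy _ N]])
    thus "x \<oplus> y \<in> {x \<in> carrier R. x [^] N \<in> B}" using xy by simp
  next
    fix a x assume "a \<in> {x \<in> carrier R. x [^] N \<in> B}" "x \<in> carrier R"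
    thus "x \<otimes> a \<in> {x \<in> carrier R. x [^] N \<in> B}"
      using ideal.I_l_closed[OF Bid] by (simp add: nat_pow_distrib)
  qed blast
qed

lemma natural_level_mult:
  assumes "ideal I R"
  shows "natural_level R I N \<subseteq> natural_level R I (N * m)"
proof
  fix x assume "x \<in> natural_level R I N"
  hence x: "x \<in> carrier R" "x [^] N \<in> ideal_box_sharp R (ideal_power R I N)"
    unfolding natural_level_def by auto
  note P = ideal_power_is_ideal[OF assms, of N]
  have "(x [^] N) [^] m \<in> ideal_power R (ideal_box_sharp R (ideal_power R I N)) m"
    by (rule pow_in_ideal_power[OF ideal_subset_carrier[OF sharp_closed_is_ideal[OF sharp_closed_box[OF P]]] x(2)])
  hence "(x [^] N) [^] m \<in> ideal_box_sharp R (ideal_power R (ideal_power R I N) m)"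
    using box_power_subset[OF P] by blast
  thus "x \<in> natural_level R I (N * m)"
    unfolding natural_level_def ideal_power_power[OF assms] using x(1) by (simp add: nat_pow_pow)
qed

lemma directed_natural_levels:
  assumes "ideal I R"
  shows "directed_family (natural_level R I ` {1..})"
  unfolding directed_family_def
proof (intro conjI ballI, blast)
  fix F G assume "F \<in> natural_level R I ` {1..}" "G \<in> natural_level R I ` {1..}"
  then obtain M N where MN: "M \<ge> 1" "F = natural_level R I M" "N \<ge> 1" "G = natural_level R I N"
    by auto
  have "M * N \<in> {1..}" using MN by simp
  moreover have "F \<subseteq> natural_level R I (M * N)" "G \<subseteq> natural_level R I (M * N)"
    using MN natural_level_mult[OF assms, of M N] natural_level_mult[OF assms, of N M]
    by (simp_all add: mult.commute)
  ultimately show "\<exists>H\<in>natural_level R I ` {1..}. F \<subseteq> H \<and> G \<subseteq> H" by blast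
qed

text \<open>Both factors are tested at the same exponent \<open>N\<close>, and \<open>(i j)\<^sup>N = i\<^sup>N j\<^sup>N\<close> lies in
  \<open>box (I\<^sup>N) \<cdot> box (J\<^sup>N) \<subseteq> box ((I \<cdot> J)\<^sup>N)\<close>. As the level of the product is an ideal, sums of
  such products follow.\<close>

lemma natural_level_prod_subset:
  assumes I: "ideal I R" and J: "ideal J R" and N: "N \<ge> 1"
  shows "natural_level R I N \<cdot> natural_level R J N \<subseteq> natural_level R (I \<cdot> J) N"
proof (rule ideal_prod_least[OF natural_level_is_ideal[OF ideal_prod_is_ideal[OF I J] N]])
  fix i j assume "i \<in> natural_level R I N" "j \<in> natural_level R J N"
  hence ij: "i \<in> carrier R" "j \<in> carrier R" "i [^] N \<in> ideal_box_sharp R (ideal_power R I N)"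
    "j [^] N \<in> ideal_box_sharp R (ideal_power R J N)"
    unfolding natural_level_def by auto
  have "i [^] N \<otimes> j [^] N \<in> ideal_box_sharp R (ideal_power R I N \<cdot> ideal_power R J N)"
    using box_prod_subset[OF ideal_power_is_ideal[OF I] ideal_power_is_ideal[OF J]] ij
    by (blast intro: ideal_prod.prod)
  thus "i \<otimes> j \<in> natural_level R (I \<cdot> J) N"
    unfolding natural_level_def ideal_power_prod[OF I J] using ij by (simp add: nat_pow_distrib)
qed

lemma natural_level_power_subset:
  assumes "ideal I R" "N \<ge> 1"
  shows "ideal_power R (natural_level R I N) m \<subseteq> natural_level R (ideal_power R I m) N"
proof (induction m)
  case 0
  have "carrier R \<subseteq> ideal_box_sharp R (carrier R)" by (rule subset_box[OF oneideal])
  thus ?case unfolding ideal_power_0 natural_level_def ideal_power_carrier by auto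
next
  case (Suc m)
  show ?case
    unfolding ideal_power_Suc
    using ideal_prod_mono[OF Suc order_refl]
      natural_level_prod_subset[OF ideal_power_is_ideal[OF assms(1)] assms] by blast
qed

section \<open>The natural closure\<close>

lemma ideal_natural_is_ideal:
  assumes "ideal I R"
  shows "ideal (ideal_natural R I) R"
  unfolding ideal_natural_eq_Union_levels
  by (rule ideal_directed_Union[OF directed_natural_levels[OF assms]])
    (use natural_level_is_ideal[OF assms] in auto)

lemma subset_ideal_natural:
  assumes "ideal I R"
  shows "I \<subseteq> ideal_natural R I"
proof
  fix x assume x: "x \<in> I"
  hence "x \<in> carrier R" using ideal.Icarr[OF assms] by blast
  hence "x \<in> natural_level R I 1"
    unfolding natural_level_def ideal_power_one[OF assms] using subset_box[OF assms] x by auto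
  thus "x \<in> ideal_natural R I" unfolding ideal_natural_eq_Union_levels by blast
qed

lemma ideal_natural_mono:
  assumes "ideal J R" "I \<subseteq> J"
  shows "ideal_natural R I \<subseteq> ideal_natural R J"
  unfolding ideal_natural_def
  using box_mono[OF ideal_power_is_ideal[OF assms(1)] ideal_power_mono[OF assms(2)]] by blast

lemma ideal_natural_power_subset:
  assumes "ideal I R"
  shows "ideal_power R (ideal_natural R I) m \<subseteq> ideal_natural R (ideal_power R I m)"
proof
  fix z assume "z \<in> ideal_power R (ideal_natural R I) m"
  then obtain N where "N \<ge> 1" "z \<in> ideal_power R (natural_level R I N) m"
    using ideal_power_directed_Union[OF directed_natural_levels[OF assms]]
    unfolding ideal_natural_eq_Union_levels by fastforce
  thus "z \<in> ideal_natural R (ideal_power R I m)"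
    using natural_level_power_subset[OF assms] unfolding ideal_natural_eq_Union_levels by fastforce
qed

text \<open>The exponents multiply: \<open>x\<^sup>m\<close> at level \<open>N\<close> of \<open>I\<^sup>m\<close> is \<open>x\<close> at level \<open>m N\<close> of \<open>I\<close>.\<close>

lemma ideal_natural_root:
  assumes "ideal I R" "x \<in> carrier R" "m \<ge> 1"
    and "x [^] m \<in> ideal_natural R (ideal_power R I m)"
  shows "x \<in> ideal_natural R I"
proof -
  obtain N :: nat where N: "N \<ge> 1"
    "(x [^] m) [^] N \<in> ideal_box_sharp R (ideal_power R (ideal_power R I m) N)"
    using assms(4) unfolding ideal_natural_def by blast
  have "x [^] (m * N) \<in> ideal_box_sharp R (ideal_power R I (m * N))"
    using N(2) assms by (simp add: nat_pow_pow ideal_power_power)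
  moreover have "m * N \<ge> 1" using N assms by simp
  ultimately show ?thesis unfolding ideal_natural_def using assms(2) by blast
qed

lemma sharp_closed_ideal_natural:
  assumes "ideal I R"
  shows "sharp_closed R (ideal_natural R I)"
  unfolding sharp_closed_def
  using ideal_natural_is_ideal[OF assms] ideal_natural_root[OF assms]
    ideal_natural_power_subset[OF assms] by blast

lemma ideal_natural_idem:
  assumes "ideal I R"
  shows "ideal_natural R (ideal_natural R I) = ideal_natural R I"
proof
  show "ideal_natural R I \<subseteq> ideal_natural R (ideal_natural R I)"
    by (rule subset_ideal_natural[OF ideal_natural_is_ideal[OF assms]])
  show "ideal_natural R (ideal_natural R I) \<subseteq> ideal_natural R I"
  proof
    fix x assume "x \<in> ideal_natural R (ideal_natural R I)"
    then obtain m :: nat where x: "x \<in> carrier R" and m: "m \<ge> 1"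
      "x [^] m \<in> ideal_box_sharp R (ideal_power R (ideal_natural R I) m)"
      unfolding ideal_natural_def[of R "ideal_natural R I"] by blast
    have "x [^] m \<in> ideal_natural R (ideal_power R I m)"
      using m(2) box_least[OF sharp_closed_ideal_natural[OF ideal_power_is_ideal[OF assms]]
          ideal_natural_power_subset[OF assms]] by blast
    thus "x \<in> ideal_natural R I" by (rule ideal_natural_root[OF assms x m(1)])
  qed
qed

end

theorem proposition2p10:
  fixes A :: "('a, 'b) ring_scheme"
  assumes "cring A"
  shows "ideal_closure_operation A (ideal_natural A)"
proof -
  interpret cring A by (rule assms)
  show ?thesis
    unfolding ideal_closure_operation_def
    using ideal_natural_is_ideal subset_ideal_natural ideal_natural_mono ideal_natural_idem by auto
qed

end
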